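(* Let $\mathcal{B}$ be a unital $C^*$-algebra with unit $I$, let $\phi$ be a faithful state on $\mathcal{B}$ (i.e. a positive linear functional with $\phi(I)=1$ and $\phi(a^*a)>0$ for every nonzero $a\in\mathcal{B}$), and let $A_1,\dots,A_n\in\mathcal{B}$ be such that $I,A_1,\dots,A_n$ are linearly independent. Put $\hat A=(I,A_1,\dots,A_n)$. Then the tuple $\hat A$ is commuting (i.e. $A_jA_k=A_kA_j$ for all $j,k$) if and only if the Hermitian metric on $P^c(\hat A)\subset\mathbb{C}^{n+1}$ defined by $\phi(\Omega_{\hat A})$ is Kähler.
   Context: Write $A_0=I$ and $\hat A(z)=z_0A_0+z_1A_1+\cdots+z_nA_n$ for $z=(z_0,\dots,z_n)\in\mathbb{C}^{n+1}$. The projective resolvent set is $P^c(\hat A)=\{z\in\mathbb{C}^{n+1}:\hat A(z)\text{ is invertible in }\mathcal{B}\}$, an open set. On it, $\omega_{\hat A}(z)=\hat A^{-1}(z)\,d\hat A(z)=\sum_{j=0}^n\hat A^{-1}(z)A_j\,dz_j$, and the fundamental form is the $\mathcal{B}$-valued $(1,1)$-form $\Omega_{\hat A}=-\omega_{\hat A}^*\wedge\omega_{\hat A}=\sum_{j,k}(\hat A^{-1}(z)A_k)^*\hat A^{-1}(z)A_j\,dz_j\wedge d\bar z_k$. Applying $\phi$ to coefficients gives the scalar $(1,1)$-form $\phi(\Omega_{\hat A})=\sum_{j,k}g_{jk}(z)\,dz_j\wedge d\bar z_k$ with $g_{jk}(z)=\phi\big((\hat A^{-1}(z)A_k)^*\hat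 A^{-1}(z)A_j\big)$. A $(1,1)$-form $\Phi=\sum g_{jk}\,dz_j\wedge d\bar z_k$ defines a Hermitian metric if the matrix $(g_{jk}(z))$ is positive definite at every point; this metric is called Kähler if $d\Phi=0$, where $d=\partial+\bar\partial$. *)

theory Defs
  imports "HOL-Analysis.Analysis" "HOL-Library.Complex_Order"
begin

section \<open>Unital $C^*$-algebras and faithful states\<close>

text \<open>
  The superclass \<^class>\<open>real_normed_algebra_1\<close> contains \<open>norm 1 = 1\<close>, which in a $C^*$-algebra
  only excludes the zero algebra; the zero algebra carries no state.
\<close>

class cstar_algebra = real_normed_algebra_1 + banach +
  fixes scaleC :: "complex \<Rightarrow> 'a \<Rightarrow> 'a" (infixr "*\<^sub>C" 75)
    and star :: "'a \<Rightarrow> 'a"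
  assumes scaleC_add_right: "c *\<^sub>C (a + b) = c *\<^sub>C a + c *\<^sub>C b"
    and scaleC_add_left: "(c + d) *\<^sub>C a = c *\<^sub>C a + d *\<^sub>C a"
    and scaleC_scaleC: "c *\<^sub>C d *\<^sub>C a = (c * d) *\<^sub>C a"
    and scaleR_scaleC: "scaleR r a = complex_of_real r *\<^sub>C a"
    and mult_scaleC_left: "(c *\<^sub>C a) * b = c *\<^sub>C (a * b)"
    and mult_scaleC_right: "a * (c *\<^sub>C b) = c *\<^sub>C (a * b)"
    and norm_scaleC: "norm (c *\<^sub>C a) = cmod c * norm a"
    and star_add: "star (a + b) = star a + star b"
    and star_scaleC: "star (c *\<^sub>C a) = cnj c *\<^sub>C star a"
    and star_mult: "star (a * b) = star b * star a"
    and star_star: "star (star a) = a"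
    and norm_star_mult_self: "norm (star a * a) = (norm a)\<^sup>2"

instantiation complex :: cstar_algebra
begin

definition "scaleC_complex (c::complex) (a::complex) = c * a"
definition "star_complex = cnj"

instance
  by standard
    (simp_all add: scaleC_complex_def star_complex_def algebra_simps norm_mult power2_eq_square
      scaleR_conv_of_real)

end

text \<open>The order on \<^typ>\<open>complex\<close> is that of \<^theory>\<open>HOL-Library.Complex_Order\<close>:
  \<open>0 \<le> c\<close> says that \<open>c\<close> is real and nonnegative.\<close>

definition state :: "('a::cstar_algebra \<Rightarrow> complex) \<Rightarrow> bool" where
  "state \<phi> \<longleftrightarrow>
     (\<forall>a b. \<phi> (a + b) = \<phi> a + \<phi> b) \<and> (\<forall>c a. \<phi> (c *\<^sub>C a) = c * \<phi> a) \<and>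
     (\<forall>a. 0 \<le> \<phi> (star a * a)) \<and> \<phi> 1 = 1"

definition faithful_state :: "('a::cstar_algebra \<Rightarrow> complex) \<Rightarrow> bool" where
  "faithful_state \<phi> \<longleftrightarrow> state \<phi> \<and> (\<forall>a. a \<noteq> 0 \<longrightarrow> 0 < \<phi> (star a * a))"

section \<open>Tuples and their projective resolvent sets\<close>

text \<open>\<open>hat_tuple A\<close> is $(I, A_1, \dots, A_n)$, where \<open>'n\<close> plays the role of $\{1,\dots,n\}$, so that
  \<open>'n option\<close> plays the role of $\{0,1,\dots,n\}$ with \<^const>\<open>None\<close> as index $0$.\<close>

definition hat_tuple :: "('n \<Rightarrow> 'a::cstar_algebra) \<Rightarrow> 'n option \<Rightarrow> 'a" where
  "hat_tuple A j = (case j of None \<Rightarrow> 1 | Some i \<Rightarrow> A i)"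

definition lin_indep_tuple :: "('k::finite \<Rightarrow> 'a::cstar_algebra) \<Rightarrow> bool" where
  "lin_indep_tuple T \<longleftrightarrow> (\<forall>c. (\<Sum>j\<in>UNIV. c j *\<^sub>C T j) = 0 \<longrightarrow> (\<forall>j. c j = 0))"

definition commuting_tuple :: "('k \<Rightarrow> 'a::cstar_algebra) \<Rightarrow> bool" where
  "commuting_tuple T \<longleftrightarrow> (\<forall>j k. T j * T k = T k * T j)"

definition pencil :: "('k::finite \<Rightarrow> 'a::cstar_algebra) \<Rightarrow> complex ^ 'k \<Rightarrow> 'a" where
  "pencil T z = (\<Sum>j\<in>UNIV. (z $ j) *\<^sub>C T j)"

definition alg_invertible :: "'a::monoid_mult \<Rightarrow> bool" where
  "alg_invertible a \<longleftrightarrow> (\<exists>b. a * b = 1 \<and> b * a = 1)"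

definition alg_inverse :: "'a::monoid_mult \<Rightarrow> 'a" where
  "alg_inverse a = (THE b. a * b = 1 \<and> b * a = 1)"

definition proj_resolvent_set :: "('k::finite \<Rightarrow> 'a::cstar_algebra) \<Rightarrow> (complex ^ 'k) set" where
  "proj_resolvent_set T = {z. alg_invertible (pencil T z)}"

section \<open>Differential forms on \<open>complex ^ 'k\<close>\<close>

text \<open>
  The value of a form of degree $p$ at a point is an alternating real-multilinear function of $p$
  tangent vectors in \<open>complex ^ 'k\<close>.  The wedge product is normalised by
  $(\alpha\wedge\beta)(u,v) = \alpha(u)\beta(v) - \alpha(v)\beta(u)$.
\<close>

definition dz :: "'k::finite \<Rightarrow> complex ^ 'k \<Rightarrow> complex" where
  "dz j v = v $ j"

definition dzbar :: "'k::finite \<Rightarrow> complex ^ 'k \<Rightarrow> complex" where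
  "dzbar j v = cnj (v $ j)"

definition wedge_1_1 :: "('v \<Rightarrow> 'a::ring) \<Rightarrow> ('v \<Rightarrow> 'a) \<Rightarrow> 'v \<Rightarrow> 'v \<Rightarrow> 'a" where
  "wedge_1_1 \<alpha> \<beta> u v = \<alpha> u * \<beta> v - \<alpha> v * \<beta> u"

definition wedge_1_2 :: "('v \<Rightarrow> 'a::ring) \<Rightarrow> ('v \<Rightarrow> 'v \<Rightarrow> 'a) \<Rightarrow> 'v \<Rightarrow> 'v \<Rightarrow> 'v \<Rightarrow> 'a" where
  "wedge_1_2 \<alpha> \<beta> u v w = \<alpha> u * \<beta> v w - \<alpha> v * \<beta> u w + \<alpha> w * \<beta> u v"

text \<open>Wirtinger derivatives $\partial f/\partial z_l$ and $\partial f/\partial\bar z_l$;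
  the Frechet derivative is that over the reals.\<close>

definition wirtinger :: "'k::finite \<Rightarrow> (complex ^ 'k \<Rightarrow> complex) \<Rightarrow> complex ^ 'k \<Rightarrow> complex" where
  "wirtinger l f z =
     (frechet_derivative f (at z) (axis l 1) - \<i> * frechet_derivative f (at z) (axis l \<i>)) / 2"

definition wirtinger_bar :: "'k::finite \<Rightarrow> (complex ^ 'k \<Rightarrow> complex) \<Rightarrow> complex ^ 'k \<Rightarrow> complex" where
  "wirtinger_bar l f z =
     (frechet_derivative f (at z) (axis l 1) + \<i> * frechet_derivative f (at z) (axis l \<i>)) / 2"

type_synonym 'k two_form = "complex ^ 'k \<Rightarrow> complex ^ 'k \<Rightarrow> complex ^ 'k \<Rightarrow> complex"

text \<open>
  $\partial\Phi = \sum_l dz_l\wedge\partial\Phi/\partial z_l$, the derivative being applied to the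
  coefficients of $\Phi$; this is differentiation of \<open>\<Phi> z u v\<close> in \<open>z\<close> for constant \<open>u v\<close>, because
  $dz_j$ and $d\bar z_k$ do not depend on \<open>z\<close>.  Likewise for $\bar\partial$.
\<close>

definition del :: "'k::finite two_form \<Rightarrow> complex ^ 'k \<Rightarrow> complex ^ 'k \<Rightarrow> complex ^ 'k \<Rightarrow> complex ^ 'k \<Rightarrow> complex" where
  "del \<Phi> z u v w = (\<Sum>l\<in>UNIV. wedge_1_2 (dz l) (\<lambda>x y. wirtinger l (\<lambda>\<zeta>. \<Phi> \<zeta> x y) z) u v w)"

definition delbar :: "'k::finite two_form \<Rightarrow> complex ^ 'k \<Rightarrow> complex ^ 'k \<Rightarrow> complex ^ 'k \<Rightarrow> complex ^ 'k \<Rightarrow> complex" where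
  "delbar \<Phi> z u v w = (\<Sum>l\<in>UNIV. wedge_1_2 (dzbar l) (\<lambda>x y. wirtinger_bar l (\<lambda>\<zeta>. \<Phi> \<zeta> x y) z) u v w)"

definition ext_deriv :: "'k::finite two_form \<Rightarrow> complex ^ 'k \<Rightarrow> complex ^ 'k \<Rightarrow> complex ^ 'k \<Rightarrow> complex ^ 'k \<Rightarrow> complex" where
  "ext_deriv \<Phi> z u v w = del \<Phi> z u v w + delbar \<Phi> z u v w"

text \<open>Differentiability is part of the definition because \<^const>\<open>frechet_derivative\<close> is arbitrary
  at points where the derivative does not exist.\<close>

definition closed_form_on :: "(complex ^ 'k) set \<Rightarrow> 'k::finite two_form \<Rightarrow> bool" where
  "closed_form_on U \<Phi> \<longleftrightarrow>
     (\<forall>z\<in>U. (\<forall>u v. (\<lambda>\<zeta>. \<Phi> \<zeta> u v) differentiable (at z)) \<and> (\<forall>u v w. ext_deriv \<Phi> z u v w = 0))"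

text \<open>In particular the quadratic form takes real values, so that \<open>G\<close> is Hermitian.\<close>

definition positive_definite :: "complex ^ 'k ^ 'k::finite \<Rightarrow> bool" where
  "positive_definite G \<longleftrightarrow>
     (\<forall>\<xi> :: complex ^ 'k. \<xi> \<noteq> 0 \<longrightarrow> 0 < (\<Sum>j\<in>UNIV. \<Sum>k\<in>UNIV. G $ j $ k * \<xi> $ j * cnj (\<xi> $ k)))"

text \<open>The coefficients $g_{jk}$ of a $(1,1)$-form are determined by the form.\<close>

definition hermitian_metric_on :: "(complex ^ 'k) set \<Rightarrow> 'k::finite two_form \<Rightarrow> bool" where
  "hermitian_metric_on U \<Phi> \<longleftrightarrow>
     (\<exists>g :: complex ^ 'k \<Rightarrow> complex ^ 'k ^ 'k. \<forall>z\<in>U.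
        (\<forall>u v. \<Phi> z u v = (\<Sum>j\<in>UNIV. \<Sum>k\<in>UNIV. g z $ j $ k * wedge_1_1 (dz j) (dzbar k) u v)) \<and>
        positive_definite (g z))"

definition kaehler_metric_on :: "(complex ^ 'k) set \<Rightarrow> 'k::finite two_form \<Rightarrow> bool" where
  "kaehler_metric_on U \<Phi> \<longleftrightarrow> hermitian_metric_on U \<Phi> \<and> closed_form_on U \<Phi>"

section \<open>The fundamental form\<close>

definition resolvent_form ::
    "('k::finite \<Rightarrow> 'a::cstar_algebra) \<Rightarrow> complex ^ 'k \<Rightarrow> complex ^ 'k \<Rightarrow> 'a" where
  "resolvent_form T z v = (\<Sum>j\<in>UNIV. dz j v *\<^sub>C (alg_inverse (pencil T z) * T j))"

definition fundamental_form ::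
    "('k::finite \<Rightarrow> 'a::cstar_algebra) \<Rightarrow> complex ^ 'k \<Rightarrow> complex ^ 'k \<Rightarrow> complex ^ 'k \<Rightarrow> 'a" where
  "fundamental_form T z u v =
     - wedge_1_1 (\<lambda>x. star (resolvent_form T z x)) (resolvent_form T z) u v"

text \<open>For linear \<open>\<phi>\<close>, applying \<open>\<phi>\<close> to the values of a form is the same as applying it to the
  coefficients; see \<open>state_form_coefficients\<close>.\<close>

definition state_form ::
    "('a::cstar_algebra \<Rightarrow> complex) \<Rightarrow> ('k::finite \<Rightarrow> 'a) \<Rightarrow> 'k two_form" where
  "state_form \<phi> T z u v = \<phi> (fundamental_form T z u v)"

lemma scaleC_zero_left: "0 *\<^sub>C (a::'a::cstar_algebra) = 0"
  using scaleC_add_left[of 0 0 a] by simp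

lemma scaleC_zero_right: "c *\<^sub>C (0::'a::cstar_algebra) = 0"
  using scaleC_add_right[of c 0 0] by simp

lemma scaleC_minus_left: "(- c) *\<^sub>C (a::'a::cstar_algebra) = - (c *\<^sub>C a)"
  using scaleC_add_left[of c "- c" a] by (simp add: scaleC_zero_left eq_neg_iff_add_eq_0 add.commute)

lemma scaleC_diff_left: "(c - d) *\<^sub>C (a::'a::cstar_algebra) = c *\<^sub>C a - d *\<^sub>C a"
  using scaleC_add_left[of c "- d" a] by (simp add: scaleC_minus_left)

lemma scaleC_sum_left: "(\<Sum>i\<in>S. f i) *\<^sub>C (a::'a::cstar_algebra) = (\<Sum>i\<in>S. f i *\<^sub>C a)"
  by (induction S rule: infinite_finite_induct) (simp_all add: scaleC_zero_left scaleC_add_left)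

lemma star_zero: "star (0::'a::cstar_algebra) = 0"
  using star_add[of 0 "0::'a"] by simp

lemma star_sum: "star (\<Sum>i\<in>S. f i) = (\<Sum>i\<in>S. star (f i :: 'a::cstar_algebra))"
  by (induction S rule: infinite_finite_induct) (simp_all add: star_zero star_add)

lemma fundamental_form_coefficients:
  fixes T :: "'k::finite \<Rightarrow> 'a::cstar_algebra"
  shows "fundamental_form T z u v =
    (\<Sum>j\<in>UNIV. \<Sum>k\<in>UNIV. wedge_1_1 (dz j) (dzbar k) u v *\<^sub>C
       (star (alg_inverse (pencil T z) * T k) * (alg_inverse (pencil T z) * T j)))"
proof -
  define X where "X j = alg_inverse (pencil T z) * T j" for j
  have prod: "star (resolvent_form T z x) * resolvent_form T z y =
      (\<Sum>j\<in>UNIV. \<Sum>k\<in>UNIV. (dzbar k x * dz j y) *\<^sub>C (star (X k) * X j))" for x y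
    by (subst sum.swap)
      (simp add: resolvent_form_def X_def[symmetric] star_sum star_scaleC sum_product
        mult_scaleC_left mult_scaleC_right scaleC_scaleC dz_def dzbar_def
        mult.commute[where 'a=complex])
  show ?thesis
    by (simp add: fundamental_form_def wedge_1_1_def prod X_def[symmetric]
        sum_subtractf[symmetric] sum_negf[symmetric] scaleC_diff_left[symmetric]
        scaleC_minus_left[symmetric] mult.commute)
qed

lemma state_form_coefficients:
  fixes T :: "'k::finite \<Rightarrow> 'a::cstar_algebra"
  assumes "state \<phi>"
  shows "state_form \<phi> T z u v =
    (\<Sum>j\<in>UNIV. \<Sum>k\<in>UNIV.
       \<phi> (star (alg_inverse (pencil T z) * T k) * (alg_inverse (pencil T z) * T j)) *
       wedge_1_1 (dz j) (dzbar k) u v)"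
proof -
  have add: "\<phi> (a + b) = \<phi> a + \<phi> b" and scale: "\<phi> (c *\<^sub>C a) = c * \<phi> a" for a b c
    using assms by (auto simp: state_def)
  have zero: "\<phi> 0 = 0"
    using add[of 0 0] by simp
  have sum: "\<phi> (\<Sum>i\<in>S. f i) = (\<Sum>i\<in>S. \<phi> (f i))" for f :: "'k \<Rightarrow> 'a" and S
    by (induction S rule: infinite_finite_induct) (simp_all add: zero add)
  show ?thesis
    by (simp add: state_form_def fundamental_form_coefficients sum scale mult.commute)
qed

end

theory Submission
  imports Defs
begin

text \<open>
  Write \<open>\<omega>(v)\<close> for the value of $\hat A^{-1} d\hat A$ on a tangent vector \<open>v\<close>. Its derivative in direction
  \<open>h\<close> is \<open>- \<omega>(h) \<omega>(v)\<close>, so that $d\phi(\Omega)$ is a sum of six terms of the form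
  \<open>\<phi>(\<omega>(v)\<^sup>* [\<omega>(u), \<omega>(w)])\<close> and \<open>\<phi>([\<omega>(u), \<omega>(w)]\<^sup>* \<omega>(v))\<close>, which vanish if the tuple commutes.
  Conversely, comparing homogeneity types, closedness forces \<open>\<phi>(\<omega>(v)\<^sup>* [\<omega>(u), \<omega>(w)]) = 0\<close> everywhere.
  Differentiating this antiholomorphically gives \<open>\<phi>((\<omega>(h) \<omega>(v))\<^sup>* [\<omega>(u), \<omega>(w)]) = 0\<close>. At
  $z = (1,0,\dots,0)$ this says that $[A_j,A_k]$ is \<open>\<phi>\<close>-orthogonal to all products, hence to itself,
  and faithfulness yields $[A_j,A_k] = 0$.
\<close>

section \<open>Inversion in a Banach algebra\<close>

lemma alg_inverse_unique:
  fixes a :: "'a::monoid_mult"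
  assumes "a * b = 1" "b * a = 1"
  shows "alg_inverse a = b"
  unfolding alg_inverse_def
proof (rule the_equality)
  fix c assume c: "a * c = 1 \<and> c * a = 1"
  have "c = c * (a * b)" using assms by simp
  also have "\<dots> = b" using c by (simp add: mult.assoc[symmetric])
  finally show "c = b" .
qed (use assms in simp)

lemma alg_inverse:
  fixes a :: "'a::monoid_mult"
  assumes "alg_invertible a"
  shows "a * alg_inverse a = 1" "alg_inverse a * a = 1"
  using assms alg_inverse_unique unfolding alg_invertible_def by metis+

lemma alg_inverse_commute:
  fixes a :: "'a::monoid_mult"
  assumes "alg_invertible a" "a * b = b * a"
  shows "alg_inverse a * b = b * alg_inverse a"
proof -
  have "alg_inverse a * b = alg_inverse a * (b * a) * alg_inverse a"
    by (simp add: mult.assoc alg_inverse[OF assms(1)])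
  also have "\<dots> = (alg_inverse a * a) * b * alg_inverse a"
    by (simp only: assms(2)[symmetric] mult.assoc)
  also have "\<dots> = b * alg_inverse a"
    by (simp add: alg_inverse[OF assms(1)])
  finally show ?thesis .
qed

lemma neumann_series:
  fixes x :: "'a::{real_normed_algebra_1,banach}"
  assumes "norm x < 1"
  shows "(1 - x) * (\<Sum>n. x ^ n) = 1" "(\<Sum>n. x ^ n) * (1 - x) = 1"
proof -
  have s: "summable (\<lambda>n. x ^ n)"
    by (rule complete_algebra_summable_geometric[OF assms])
  have e: "(\<Sum>n. x ^ n) = 1 + (\<Sum>n. x ^ Suc n)"
    using suminf_split_head[OF s] by simp
  have "x * (\<Sum>n. x ^ n) = (\<Sum>n. x ^ Suc n)"
    using suminf_mult[OF s, of x] by simp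
  then show "(1 - x) * (\<Sum>n. x ^ n) = 1"
    using e by (simp add: left_diff_distrib)
  have "(\<Sum>n. x ^ n) * x = (\<Sum>n. x ^ Suc n)"
    using suminf_mult2[OF s, of x] by (simp only: power_Suc2)
  then show "(\<Sum>n. x ^ n) * (1 - x) = 1"
    using e by (simp add: right_diff_distrib)
qed

text \<open>Factor \<open>b\<close> as \<open>a * (1 - x)\<close> with \<open>x\<close> small and
  invert \<open>1 - x\<close> by the Neumann series. The bound on the inverse, uniform near
  \<open>a\<close>, later makes the remainder of the derivative quadratic.\<close>

lemma alg_invertible_perturb:
  fixes a b :: "'a::{real_normed_algebra_1,banach}"
  assumes a: "alg_invertible a" and b: "norm (alg_inverse a) * norm (b - a) \<le> 1 / 2"
  shows "alg_invertible b" "norm (alg_inverse b) \<le> 2 * norm (alg_inverse a)"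
proof -
  define r where "r = alg_inverse a"
  define x where "x = - (r * (b - a))"
  have r: "a * r = 1" "r * a = 1"
    using alg_inverse[OF a] by (simp_all add: r_def)
  have x: "norm x \<le> 1 / 2"
    using norm_mult_ineq[of r "b - a"] b by (simp add: x_def r_def)
  define w where "w = (\<Sum>n. x ^ n)"
  have w: "(1 - x) * w = 1" "w * (1 - x) = 1"
    unfolding w_def by (rule neumann_series; use x in simp)+
  have b_eq: "b = a * (1 - x)"
    by (simp add: x_def algebra_simps r mult.assoc[symmetric])
  have inv: "b * (w * r) = 1" "(w * r) * b = 1"
    using w r unfolding b_eq by (metis mult.assoc mult_1_left)+
  then show "alg_invertible b"
    unfolding alg_invertible_def by blast
  \<comment> \<open>Estimating \<open>w = 1 + w * x\<close> gives
    \<open>norm w \<le> 1 + norm w / 2\<close>, hence the factor 2.\<close>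
  have "norm w = norm (1 + w * x)"
    using w(2) by (simp add: algebra_simps)
  also have "\<dots> \<le> 1 + norm w * norm x"
    by (metis norm_triangle_le add_left_mono norm_mult_ineq norm_one)
  also have "\<dots> \<le> 1 + norm w * (1 / 2)"
    by (intro add_left_mono mult_left_mono x) auto
  finally have "norm w \<le> 2" by simp
  then have "norm w * norm r \<le> 2 * norm r"
    by (rule mult_right_mono) simp
  then show "norm (alg_inverse b) \<le> 2 * norm (alg_inverse a)"
    unfolding alg_inverse_unique[OF inv] r_def[symmetric]
    by (rule order_trans[OF norm_mult_ineq])
qed

lemma eventually_small_perturbation:
  fixes a :: "'a::{real_normed_algebra_1,banach}"
  assumes "alg_invertible a"
  shows "\<forall>\<^sub>F b in nhds a. norm (alg_inverse a) * norm (b - a) \<le> 1 / 2"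
proof -
  have "((\<lambda>b. norm (alg_inverse a) * norm (b - a)) \<longlongrightarrow> norm (alg_inverse a) * norm (a - a)) (nhds a)"
    by (intro tendsto_intros filterlim_ident)
  from order_tendstoD(2)[OF this, of "1 / 2"] show ?thesis
    by (auto elim: eventually_mono)
qed

lemma open_alg_invertible: "open {a :: 'a::{real_normed_algebra_1,banach}. alg_invertible a}"
  unfolding open_subopen[of "Collect _"] eventually_nhds[symmetric]
  by (metis (no_types, lifting) eventually_nhds alg_invertible_perturb(1) eventually_small_perturbation
      mem_Collect_eq subsetI)

lemma has_derivative_alg_inverse:
  fixes a :: "'a::{real_normed_algebra_1,banach}"
  assumes a: "alg_invertible a"
  shows "(alg_inverse has_derivative (\<lambda>h. - (alg_inverse a * h * alg_inverse a))) (at a)"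
proof -
  define r where "r = alg_inverse a"
  obtain e where e: "e > 0" "\<And>b. dist b a < e \<Longrightarrow> norm r * norm (b - a) \<le> 1 / 2"
    using eventually_small_perturbation[OF a] unfolding eventually_nhds_metric r_def by blast
  have "(alg_inverse has_derivative (\<lambda>h. - (r * h * r))) (at a)"
  \<comment> \<open>The constant comes from \<open>norm s \<le> 2 * norm r\<close> and two further
    factors \<open>r\<close>; of the two factors \<open>norm (b - a)\<close> one is cancelled by the
    quotient.\<close>
  proof (rule has_derivativeI_sandwich[OF e(1), where H = "\<lambda>b. 2 * norm r ^ 3 * norm (b - a)"])
    show "bounded_linear (\<lambda>h. - (r * h * r))"
      by (intro bounded_linear_minus
          bounded_linear_compose[OF bounded_linear_mult_left bounded_linear_mult_right])
    have "((\<lambda>b. 2 * norm r ^ 3 * norm (b - a)) \<longlongrightarrow> 2 * norm r ^ 3 * norm (a - a)) (at a)"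
      by (intro tendsto_intros)
    then show "((\<lambda>b. 2 * norm r ^ 3 * norm (b - a)) \<longlongrightarrow> 0) (at a)"
      by simp
    fix b assume "b \<noteq> a" and near: "dist b a < e"
    define s where "s = alg_inverse b"
    note b = alg_invertible_perturb[OF a, folded r_def, OF e(2)[OF near], folded s_def]
    have s: "b * s = 1" "s * b = 1"
      using alg_inverse[OF b(1)] by (simp_all add: s_def)
    have r: "a * r = 1" "r * a = 1"
      using alg_inverse[OF a] by (simp_all add: r_def)
    \<comment> \<open>The resolvent identity; applied again with the extra factor
      \<open>(b - a) * r\<close>, it exhibits the remainder as a term of second order.\<close>
    have "s * (b - a) * r = r - s"
      using s r by (simp add: algebra_simps)
    moreover have "r * (b - a) * r = r * b * r - r"
      using r by (simp add: algebra_simps)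
    moreover have "s * (b - a) * r * (b - a) * r = (s * (b - a) * r) * b * r - (s * (b - a) * r)"
      using r by (simp add: algebra_simps)
    ultimately have "s - r - - (r * (b - a) * r) = s * (b - a) * r * (b - a) * r"
      using s by (simp add: algebra_simps)
    also have "norm \<dots> \<le> norm s * norm (b - a) * norm r * norm (b - a) * norm r"
      by (intro order_trans[OF norm_mult_ineq] mult_right_mono order_refl) auto
    also have "\<dots> \<le> 2 * norm r * norm (b - a) * norm r * norm (b - a) * norm r"
      by (intro mult_right_mono b(2)) auto
    also have "\<dots> = 2 * norm r ^ 3 * norm (b - a) * norm (b - a)"
      by (simp add: power3_eq_cube)
    finally show "norm (alg_inverse b - alg_inverse a - - (r * (b - a) * r)) / norm (b - a)
        \<le> 2 * norm r ^ 3 * norm (b - a)"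
      using \<open>b \<noteq> a\<close> by (simp add: divide_le_eq s_def r_def)
  qed
  then show ?thesis by (simp add: r_def)
qed

section \<open>Continuity of the involution and of states\<close>

lemma scaleC_minus_right: "c *\<^sub>C (- a) = - (c *\<^sub>C (a :: 'a::cstar_algebra))"
  using scaleC_add_right[of c a "- a"] by (simp add: scaleC_zero_right eq_neg_iff_add_eq_0 add.commute)

lemma scaleC_diff_right: "c *\<^sub>C (a - b) = c *\<^sub>C a - c *\<^sub>C (b :: 'a::cstar_algebra)"
  using scaleC_add_right[of c a "- b"] by (simp add: scaleC_minus_right)

lemma scaleC_sum_right: "c *\<^sub>C (\<Sum>i\<in>S. f i) = (\<Sum>i\<in>S. c *\<^sub>C (f i :: 'a::cstar_algebra))"
  by (induction S rule: infinite_finite_induct) (simp_all add: scaleC_zero_right scaleC_add_right)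

lemma scaleC_one: "1 *\<^sub>C a = (a :: 'a::cstar_algebra)"
  using scaleR_scaleC[of 1 a] by simp

text \<open>The C*-identity and submultiplicativity, then cancelling one \<open>norm a\<close>;
  applied also to \<open>star a\<close>, this makes the involution isometric.\<close>

lemma norm_star_le: "norm (a :: 'a::cstar_algebra) \<le> norm (star a)"
proof (cases "a = 0")
  case False
  have "norm a * norm a \<le> norm (star a) * norm a"
    using norm_mult_ineq[of "star a" a] norm_star_mult_self[of a] by (simp add: power2_eq_square)
  then show ?thesis using False by simp
qed simp

lemma norm_star [simp]: "norm (star (a :: 'a::cstar_algebra)) = norm a"
  using norm_star_le[of a] norm_star_le[of "star a"] by (simp add: star_star)

lemma star_scaleR: "star (r *\<^sub>R a) = r *\<^sub>R star (a :: 'a::cstar_algebra)"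
  by (simp add: scaleR_scaleC star_scaleC)

lemma bounded_linear_star: "bounded_linear (star :: 'a::cstar_algebra \<Rightarrow> 'a)"
  by (rule bounded_linear_intro[where K = 1]) (simp_all add: star_add star_scaleR)

lemma star_minus: "star (- a) = - star (a :: 'a::cstar_algebra)"
  using star_scaleR[of "-1" a] by simp

lemma star_diff: "star (a - b) = star a - star (b :: 'a::cstar_algebra)"
  using star_add[of a "- b"] by (simp add: star_minus)

lemma star_one [simp]: "star 1 = (1 :: 'a::cstar_algebra)"
  by (metis mult_1_left mult_1_right star_mult star_star)

section \<open>Self-adjoint square roots near the unit\<close>

lemma star_power: "star (a ^ n) = star (a :: 'a::cstar_algebra) ^ n"
  by (induction n) (simp_all add: star_mult power_commutes)

text \<open>By Vandermonde's identity the Cauchy square of the series has coefficients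
  \<open>1 gchoose k\<close>, which vanish beyond \<open>k = 1\<close>.\<close>

lemma binomial_series_sqrt:
  fixes x :: "'a::{real_normed_algebra_1,banach}"
  assumes "norm x < 1"
  defines "s \<equiv> (\<Sum>n. ((1 / 2 :: real) gchoose n) *\<^sub>R x ^ n)"
  shows "summable (\<lambda>n. ((1 / 2 :: real) gchoose n) *\<^sub>R x ^ n)" "s * s = 1 + x"
proof -
  define c where "c n = ((1 / 2 :: real) gchoose n)" for n
  \<comment> \<open>The convergence radius is 1 for exponents that are not natural numbers.\<close>
  have half: "(1 / 2 :: real) \<notin> \<nat>"
  proof
    assume "(1 / 2 :: real) \<in> \<nat>"
    then obtain n where "1 / 2 = real n" by (auto elim: Nats_cases)
    then have "real (2 * n) = real 1" by simp
    then have "2 * n = 1" by (simp only: of_nat_eq_iff)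
    then show False by presburger
  qed
  have "summable (\<lambda>n. norm (c n * norm x ^ n))"
    unfolding c_def using assms half by (intro abs_summable_in_conv_radius) (simp add: conv_radius_gchoose)
  then have abs: "summable (\<lambda>n. norm (c n *\<^sub>R x ^ n))"
    by (rule summable_comparison_test') (auto simp: abs_mult intro!: mult_left_mono norm_power_ineq)
  then show "summable (\<lambda>n. ((1 / 2 :: real) gchoose n) *\<^sub>R x ^ n)"
    unfolding c_def by (rule summable_norm_cancel)
  have "(\<Sum>i\<le>k. (c i *\<^sub>R x ^ i) * (c (k - i) *\<^sub>R x ^ (k - i))) = (1 gchoose k) *\<^sub>R x ^ k" for k
  proof -
    have "(\<Sum>i\<le>k. (c i *\<^sub>R x ^ i) * (c (k - i) *\<^sub>R x ^ (k - i))) = (\<Sum>i\<le>k. (c i * c (k - i)) *\<^sub>R x ^ k)"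
      by (intro sum.cong refl) (simp add: power_add[symmetric])
    also have "\<dots> = (\<Sum>i=0..k. c i * c (k - i)) *\<^sub>R x ^ k"
      by (simp add: scaleR_sum_left atMost_atLeast0)
    also have "(\<Sum>i=0..k. c i * c (k - i)) = (1 gchoose k)"
      unfolding c_def gbinomial_Vandermonde by simp
    finally show ?thesis .
  qed
  then have "(\<lambda>k. (1 gchoose k) *\<^sub>R x ^ k) sums (s * s)"
    using Cauchy_product_sums[OF abs abs] unfolding s_def c_def[symmetric] by simp
  moreover have "(\<lambda>k. (1 gchoose k) *\<^sub>R x ^ k) sums (\<Sum>k\<in>{0, 1}. (1 gchoose k) *\<^sub>R x ^ k)"
  proof (rule sums_finite)
    fix k :: nat assume "k \<notin> {0, 1}"
    then have "1 < k" by auto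
    then have "(of_nat 1 gchoose k :: real) = 0"
      by (simp only: binomial_gbinomial[symmetric] binomial_eq_0 of_nat_0)
    then show "(1 gchoose k) *\<^sub>R x ^ k = 0" by simp
  qed simp
  ultimately show "s * s = 1 + x"
    by (simp add: sums_unique2)
qed

text \<open>The coefficients are real, so the involution fixes the series. Thereby
  \<open>1 + x\<close> takes the shape on which a state is nonnegative.\<close>

lemma selfadjoint_sqrt:
  fixes x :: "'a::cstar_algebra"
  assumes "norm x < 1" "star x = x"
  obtains s where "star s * s = 1 + x"
proof
  define s where "s = (\<Sum>n. ((1 / 2 :: real) gchoose n) *\<^sub>R x ^ n)"
  have "star s = s"
    unfolding s_def bounded_linear.suminf[OF bounded_linear_star binomial_series_sqrt(1)[OF assms(1)]]
    by (simp add: star_scaleR star_power assms(2))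
  then show "star s * s = 1 + x"
    using binomial_series_sqrt(2)[OF assms(1)] by (simp add: s_def)
qed

section \<open>Reality and boundedness of states\<close>

lemma state_simps:
  fixes \<phi> :: "'a::cstar_algebra \<Rightarrow> complex"
  assumes "state \<phi>"
  shows "\<phi> (a + b) = \<phi> a + \<phi> b" "\<phi> (c *\<^sub>C a) = c * \<phi> a" "\<phi> 0 = 0" "\<phi> (- a) = - \<phi> a"
    "\<phi> (a - b) = \<phi> a - \<phi> b" "\<phi> (r *\<^sub>R a) = r *\<^sub>R \<phi> a"
proof -
  show add: "\<phi> (a + b) = \<phi> a + \<phi> b" and scale: "\<phi> (c *\<^sub>C a) = c * \<phi> a" for a b c
    using assms by (auto simp: state_def)
  show "\<phi> 0 = 0"
    using add[of 0 0] by simp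
  then show minus: "\<phi> (- a) = - \<phi> a" for a
    using add[of a "- a"] by (simp add: eq_neg_iff_add_eq_0 add.commute)
  show "\<phi> (a - b) = \<phi> a - \<phi> b"
    using add[of a "- b"] by (simp add: minus)
  show "\<phi> (r *\<^sub>R a) = r *\<^sub>R \<phi> a"
    by (simp add: scaleR_scaleC[where 'a='a] scale scaleR_conv_of_real)
qed

text \<open>Polarization against the unit writes four times \<open>a\<close> as a difference of two
  elements \<open>star b * b\<close>.\<close>

lemma state_selfadjoint_real:
  assumes "state \<phi>" "star a = a"
  shows "Im (\<phi> a) = 0"
proof -
  have "4 *\<^sub>R a = star (a + 1) * (a + 1) - star (a - 1) * (a - 1)"
    using scaleR_left_distrib[of 2 2 a] by (simp add: star_add star_diff assms(2) algebra_simps scaleR_2)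
  then have "4 * \<phi> a = \<phi> (star (a + 1) * (a + 1)) - \<phi> (star (a - 1) * (a - 1))"
    by (metis state_simps(5,6)[OF assms(1)] scaleR_conv_of_real of_real_numeral)
  moreover have "Im (\<phi> (star b * b)) = 0" for b
    using assms(1) by (simp add: state_def less_eq_complex_def)
  ultimately have "Im (4 * \<phi> a) = 0"
    by simp
  then show ?thesis by simp
qed

text \<open>If \<open>a\<close> is self-adjoint of norm below one, then \<open>1 + a\<close> and \<open>1 - a\<close> are squares of
  self-adjoint elements, so \<open>\<phi> a\<close> lies between \<open>-1\<close> and \<open>1\<close>.\<close>

lemma norm_state_selfadjoint_le:
  assumes \<phi>: "state \<phi>" and a: "star a = a"
  shows "norm (\<phi> a) \<le> 2 * norm a"
proof (cases "a = 0")
  case False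
  \<comment> \<open>Scaling brings the norm to 1/2, strictly below the radius 1 of the square root
    series; this is where the factor 2 arises.\<close>
  define t where "t = 1 / (2 * norm a)"
  have t: "t > 0" using False by (simp add: t_def)
  have bound: "Re (\<phi> x) \<ge> - 1" if x: "norm x < 1" "star x = x" for x
  proof -
    obtain s where "star s * s = 1 + x"
      by (rule selfadjoint_sqrt[OF x])
    moreover have "0 \<le> \<phi> (star s * s)" "\<phi> 1 = 1"
      using \<phi> by (auto simp: state_def)
    ultimately show ?thesis
      by (simp add: state_simps[OF \<phi>] less_eq_complex_def)
  qed
  have n: "norm (t *\<^sub>R a) < 1" "norm (- (t *\<^sub>R a)) < 1"
    using False by (simp_all add: t_def)
  have "\<bar>Re (\<phi> (t *\<^sub>R a))\<bar> \<le> 1"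
    using bound[OF n(1)] bound[OF n(2)] by (simp add: star_scaleR star_minus a state_simps[OF \<phi>])
  then have "t * \<bar>Re (\<phi> a)\<bar> \<le> 1"
    using t by (simp add: state_simps[OF \<phi>] abs_mult)
  then have "\<bar>Re (\<phi> a)\<bar> \<le> 2 * norm a"
    using False by (simp add: t_def field_simps)
  then show ?thesis
    using state_selfadjoint_real[OF \<phi> a] by (simp add: cmod_def)
qed (simp add: state_simps[OF \<phi>])

lemma selfadjoint_decomposition:
  fixes a :: "'a::cstar_algebra"
  obtains h k where "a = h + \<i> *\<^sub>C k" "star h = h" "star k = k" "norm h \<le> norm a" "norm k \<le> norm a"
proof
  define h where "h = (1/2) *\<^sub>R (a + star a)"
  define k where "k = (- \<i> / 2) *\<^sub>C (a - star a)"
  have "\<i> *\<^sub>C k = (1/2) *\<^sub>R (a - star a)"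
    by (simp add: k_def scaleC_scaleC scaleR_scaleC)
  then show "a = h + \<i> *\<^sub>C k"
    by (simp add: h_def scaleR_add_right[symmetric] scaleR_2[symmetric])
  show "star h = h"
    by (simp add: h_def star_scaleR star_add star_star add.commute)
  show "star k = k"
    by (simp add: k_def star_scaleC star_diff star_star scaleC_diff_right scaleC_minus_left)
  show "norm h \<le> norm a"
    using norm_triangle_ineq[of a "star a"] by (simp add: h_def)
  show "norm k \<le> norm a"
    using norm_triangle_ineq4[of a "star a"] by (simp add: k_def norm_scaleC norm_divide)
qed

text \<open>Makes it possible to differentiate through \<open>\<phi>\<close>. The constant 4 is 2
  for each of the real and imaginary parts of \<open>a\<close>.\<close>

lemma bounded_linear_state:
  fixes \<phi> :: "'a::cstar_algebra \<Rightarrow> complex"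
  assumes \<phi>: "state \<phi>"
  shows "bounded_linear \<phi>"
proof (rule bounded_linear_intro[where K = 4])
  fix a :: 'a
  obtain h k where hk: "a = h + \<i> *\<^sub>C k" "star h = h" "star k = k" "norm h \<le> norm a" "norm k \<le> norm a"
    by (rule selfadjoint_decomposition)
  have "norm (\<phi> a) \<le> norm (\<phi> h) + norm (\<phi> k)"
    using norm_triangle_ineq[of "\<phi> h" "\<i> * \<phi> k"] by (simp add: hk(1) state_simps[OF \<phi>] norm_mult)
  also have "\<dots> \<le> norm a * 4"
    using norm_state_selfadjoint_le[OF \<phi> hk(2)] norm_state_selfadjoint_le[OF \<phi> hk(3)] hk(4,5) by simp
  finally show "norm (\<phi> a) \<le> norm a * 4" .
qed (simp_all add: state_simps[OF \<phi>])

section \<open>The resolvent form\<close>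

lemma pencil_add: "pencil T (u + v) = pencil T u + pencil T v"
  by (simp add: pencil_def scaleC_add_left sum.distrib)

lemma pencil_scale: "pencil T (c *s v) = c *\<^sub>C pencil T v"
  by (simp add: pencil_def scaleC_scaleC scaleC_sum_right)

lemma pencil_axis: "pencil T (axis j 1) = T j"
  by (simp add: pencil_def axis_def if_distrib[of "\<lambda>c. c *\<^sub>C _"] scaleC_one scaleC_zero_left cong: if_cong)

lemma bounded_linear_pencil:
  fixes T :: "'k::finite \<Rightarrow> 'a::cstar_algebra"
  shows "bounded_linear (pencil T)"
proof -
  have "pencil T (r *\<^sub>R v) = r *\<^sub>R pencil T v" for r v
    by (simp add: pencil_def scaleR_scaleC[where 'a='a] scaleC_scaleC scaleC_sum_right
        scaleR_conv_of_real[where 'a=complex])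
  then show ?thesis
    by (simp add: linear_conv_bounded_linear[symmetric] linear_iff pencil_add)
qed

lemma resolvent_form_eq: "resolvent_form T z v = alg_inverse (pencil T z) * pencil T v"
  by (simp add: resolvent_form_def dz_def pencil_def sum_distrib_left mult_scaleC_right)

lemma resolvent_form_add:
  "resolvent_form T z (u + v) = resolvent_form T z u + resolvent_form T z v"
  by (simp add: resolvent_form_eq pencil_add algebra_simps)

lemma resolvent_form_scale: "resolvent_form T z (c *s v) = c *\<^sub>C resolvent_form T z v"
  by (simp add: resolvent_form_eq pencil_scale mult_scaleC_right)

lemma open_proj_resolvent_set: "open (proj_resolvent_set T)"
proof -
  have "proj_resolvent_set T = pencil T -` {a. alg_invertible a}"
    by (auto simp: proj_resolvent_set_def)
  moreover have "continuous_on UNIV (pencil T)"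
    by (rule linear_continuous_on[OF bounded_linear_pencil])
  ultimately show ?thesis
    by (simp only: open_vimage[OF open_alg_invertible])
qed

text \<open>The pencil is linear, hence its own derivative; the chain rule with the derivative of
  inversion does the rest.\<close>

lemma has_derivative_resolvent_form:
  assumes "z \<in> proj_resolvent_set T"
  shows "((\<lambda>\<zeta>. resolvent_form T \<zeta> v) has_derivative
    (\<lambda>h. - (resolvent_form T z h * resolvent_form T z v))) (at z)"
proof -
  have inv: "alg_invertible (pencil T z)"
    using assms by (simp add: proj_resolvent_set_def)
  have "(pencil T has_derivative pencil T) (at z)"
    by (rule bounded_linear_imp_has_derivative[OF bounded_linear_pencil])
  from has_derivative_compose[OF this has_derivative_alg_inverse[OF inv]]
  have "((\<lambda>\<zeta>. alg_inverse (pencil T \<zeta>)) has_derivative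
      (\<lambda>h. - (alg_inverse (pencil T z) * pencil T h * alg_inverse (pencil T z)))) (at z)" .
  from has_derivative_mult_left[OF this, of "pencil T v"] show ?thesis
    by (simp add: resolvent_form_eq mult.assoc)
qed

lemma has_derivative_state_product:
  assumes \<phi>: "state \<phi>" and f: "(f has_derivative f') (at z)" and g: "(g has_derivative g') (at z)"
  shows "((\<lambda>\<zeta>. \<phi> (star (f \<zeta>) * g \<zeta>)) has_derivative
    (\<lambda>h. \<phi> (star (f' h) * g z) + \<phi> (star (f z) * g' h))) (at z)"
proof -
  note star = bounded_linear.has_derivative[OF bounded_linear_star f]
  from bounded_linear.has_derivative[OF bounded_linear_state[OF \<phi>] has_derivative_mult[OF star g]]
  show ?thesis
    by (simp add: state_simps[OF \<phi>] add.commute)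
qed

section \<open>The exterior derivative of the fundamental form\<close>

lemma state_form_eq:
  assumes "state \<phi>"
  shows "state_form \<phi> T z u v =
    \<phi> (star (resolvent_form T z v) * resolvent_form T z u) -
    \<phi> (star (resolvent_form T z u) * resolvent_form T z v)"
  by (simp add: state_form_def fundamental_form_def wedge_1_1_def state_simps[OF assms])

text \<open>The first bracket is complex linear in \<open>h\<close>, the second antilinear because
  \<open>star\<close> conjugates scalars; they feed \<open>del\<close> and \<open>delbar\<close>
  respectively.\<close>

lemma has_derivative_state_form:
  assumes \<phi>: "state \<phi>" and z: "z \<in> proj_resolvent_set T"
  defines "\<omega> \<equiv> resolvent_form T z"
  shows "((\<lambda>\<zeta>. state_form \<phi> T \<zeta> u v) has_derivative
    (\<lambda>h. (\<phi> (star (\<omega> u) * (\<omega> h * \<omega> v)) - \<phi> (star (\<omega> v) * (\<omega> h * \<omega> u))) +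
         (\<phi> (star (\<omega> h * \<omega> u) * \<omega> v) - \<phi> (star (\<omega> h * \<omega> v) * \<omega> u)))) (at z)"
proof -
  note d = has_derivative_resolvent_form[OF z, folded \<omega>_def]
  from has_derivative_diff[OF has_derivative_state_product[OF \<phi> d[of v] d[of u]]
      has_derivative_state_product[OF \<phi> d[of u] d[of v]]]
  show ?thesis
    unfolding state_form_eq[OF \<phi>]
    by (rule has_derivative_eq_rhs) (simp add: \<omega>_def star_minus state_simps[OF \<phi>] fun_eq_iff)
qed

text \<open>\<open>L\<close> and \<open>M\<close> are the complex linear and antilinear parts of the
  real derivative. Each Wirtinger combination doubles one of them and cancels the other.\<close>

lemma wirtinger_eqI:
  assumes "(f has_derivative (\<lambda>h. L h + M h)) (at z)"
    and "\<And>v. L (\<i> *s v) = \<i> * L v" and "\<And>v. M (\<i> *s v) = - \<i> * M v"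
  shows "wirtinger l f z = L (axis l 1)" "wirtinger_bar l f z = M (axis l 1)"
proof -
  have "axis l \<i> = \<i> *s axis l 1"
    by (simp add: vec_eq_iff axis_def)
  then have "L (axis l \<i>) = \<i> * L (axis l 1)" "M (axis l \<i>) = - \<i> * M (axis l 1)"
    using assms(2,3) by simp_all
  then show "wirtinger l f z = L (axis l 1)" "wirtinger_bar l f z = M (axis l 1)"
    by (simp_all add: wirtinger_def wirtinger_bar_def frechet_derivative_at[OF assms(1), symmetric]
        algebra_simps)
qed

text \<open>Collapses the sum over \<open>l\<close> in \<open>del\<close> to the linear part of the
  derivative in a single direction; the antilinear analogue serves \<open>delbar\<close>.\<close>

lemma linear_axis_expansion:
  fixes L :: "complex ^ 'k::finite \<Rightarrow> complex"
  assumes add: "\<And>u v. L (u + v) = L u + L v" and scale: "\<And>c v. L (c *s v) = c * L v"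
  shows "(\<Sum>l\<in>UNIV. u $ l * L (axis l 1)) = L u"
proof -
  have "L 0 = 0"
    using add[of 0 0] by simp
  then have "(\<Sum>l\<in>S. u $ l * L (axis l 1)) = L (\<Sum>l\<in>S. u $ l *s axis l 1)" for S
    by (induction S rule: infinite_finite_induct) (simp_all add: add scale)
  then show ?thesis
    by (simp add: basis_expansion)
qed

lemma antilinear_axis_expansion:
  fixes L :: "complex ^ 'k::finite \<Rightarrow> complex"
  assumes "\<And>u v. L (u + v) = L u + L v" and "\<And>c v. L (c *s v) = cnj c * L v"
  shows "(\<Sum>l\<in>UNIV. cnj (u $ l) * L (axis l 1)) = L u"
proof -
  have "(\<Sum>l\<in>UNIV. u $ l * cnj (L (axis l 1))) = cnj (L u)"
    by (rule linear_axis_expansion) (simp_all add: assms)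
  then have "cnj (\<Sum>l\<in>UNIV. u $ l * cnj (L (axis l 1))) = L u"
    by simp
  then show ?thesis by simp
qed

lemma ext_deriv_state_form:
  assumes \<phi>: "state \<phi>" and z: "z \<in> proj_resolvent_set T"
  defines "\<omega> \<equiv> resolvent_form T z"
  defines "comm \<equiv> \<lambda>u v. \<omega> u * \<omega> v - \<omega> v * \<omega> u"
  shows "ext_deriv (state_form \<phi> T) z u v w =
    \<phi> (star (\<omega> v) * comm u w) - \<phi> (star (\<omega> w) * comm u v) - \<phi> (star (\<omega> u) * comm v w) +
    \<phi> (star (comm w u) * \<omega> v) + \<phi> (star (comm u v) * \<omega> w) + \<phi> (star (comm v w) * \<omega> u)"
proof -
  define P where "P x y h = \<phi> (star (\<omega> x) * (\<omega> h * \<omega> y)) - \<phi> (star (\<omega> y) * (\<omega> h * \<omega> x))" for x y h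
  define Q where "Q x y h = \<phi> (star (\<omega> h * \<omega> x) * \<omega> y) - \<phi> (star (\<omega> h * \<omega> y) * \<omega> x)" for x y h
  note alg = \<omega>_def resolvent_form_add resolvent_form_scale star_add star_scaleC star_mult
    mult_scaleC_left mult_scaleC_right distrib_left distrib_right state_simps[OF \<phi>]
  have P: "P x y (g + h) = P x y g + P x y h" "P x y (c *s h) = c * P x y h" for x y g h c
    by (simp_all add: P_def alg right_diff_distrib)
  have Q: "Q x y (g + h) = Q x y g + Q x y h" "Q x y (c *s h) = cnj c * Q x y h" for x y g h c
    by (simp_all add: Q_def alg right_diff_distrib)
  have D: "((\<lambda>\<zeta>. state_form \<phi> T \<zeta> x y) has_derivative (\<lambda>h. P x y h + Q x y h)) (at z)" for x y
    unfolding P_def Q_def \<omega>_def by (rule has_derivative_state_form[OF \<phi> z])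
  have W: "wirtinger l (\<lambda>\<zeta>. state_form \<phi> T \<zeta> x y) z = P x y (axis l 1)"
    "wirtinger_bar l (\<lambda>\<zeta>. state_form \<phi> T \<zeta> x y) z = Q x y (axis l 1)" for l x y
    by (rule wirtinger_eqI[OF D]; simp add: P Q)+
  have "del (state_form \<phi> T) z u v w = P v w u - P u w v + P u v w"
    using linear_axis_expansion[of "P _ _", OF P]
    by (simp add: del_def wedge_1_2_def W dz_def sum.distrib sum_subtractf)
  moreover have "delbar (state_form \<phi> T) z u v w = Q v w u - Q u w v + Q u v w"
    using antilinear_axis_expansion[of "Q _ _", OF Q]
    by (simp add: delbar_def wedge_1_2_def W dzbar_def sum.distrib sum_subtractf)
  \<comment> \<open>In the alternating sums of \<open>P\<close>, products with the same starred
    factor pair up into a commutator; for \<open>Q\<close> those with the same unstarred factor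
    do.\<close>
  ultimately show ?thesis
    by (simp add: ext_deriv_def P_def Q_def comm_def star_diff left_diff_distrib right_diff_distrib
        state_simps[OF \<phi>])
qed

section \<open>Positivity, and closedness in the commuting case\<close>

text \<open>The quadratic form at \<open>\<xi>\<close> is \<open>\<phi> (star a * a)\<close> for
  \<open>a = resolvent_form T z \<xi>\<close>. Linear independence makes
  \<open>pencil T \<xi>\<close> nonzero, and so \<open>a\<close> is nonzero too.\<close>

lemma hermitian_metric_on_state_form:
  assumes \<phi>: "faithful_state \<phi>" and T: "lin_indep_tuple T"
  shows "hermitian_metric_on (proj_resolvent_set T) (state_form \<phi> T)"
proof -
  have st: "state \<phi>" and faithful: "\<And>a. a \<noteq> 0 \<Longrightarrow> 0 < \<phi> (star a * a)"
    using \<phi> by (auto simp: faithful_state_def)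
  define X where "X z j = alg_inverse (pencil T z) * T j" for z j
  define g where "g z = (\<chi> j k. \<phi> (star (X z k) * X z j))" for z
  have sum: "\<phi> (\<Sum>i\<in>S. f i) = (\<Sum>i\<in>S. \<phi> (f i))" for f :: "_ \<Rightarrow> 'a" and S
    by (induction S rule: infinite_finite_induct) (simp_all add: state_simps[OF st])
  have "positive_definite (g z)" if z: "z \<in> proj_resolvent_set T" for z
    unfolding positive_definite_def
  proof (intro allI impI)
    fix \<xi> :: "complex ^ 'b" assume "\<xi> \<noteq> 0"
    then have "pencil T \<xi> \<noteq> 0"
      using T by (auto simp: lin_indep_tuple_def pencil_def vec_eq_iff)
    moreover have "pencil T \<xi> = pencil T z * resolvent_form T z \<xi>"
      using z alg_inverse(1)[of "pencil T z"]
      by (simp add: resolvent_form_eq mult.assoc[symmetric] proj_resolvent_set_def)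
    ultimately have "resolvent_form T z \<xi> \<noteq> 0" by auto
    moreover have "\<phi> (star (resolvent_form T z \<xi>) * resolvent_form T z \<xi>) =
        (\<Sum>j\<in>UNIV. \<Sum>k\<in>UNIV. g z $ j $ k * \<xi> $ j * cnj (\<xi> $ k))"
      unfolding resolvent_form_def X_def[symmetric] star_sum sum_product sum
      by (subst sum.swap)
        (simp add: g_def dz_def star_scaleC mult_scaleC_left mult_scaleC_right state_simps[OF st] mult_ac)
    ultimately show "0 < (\<Sum>j\<in>UNIV. \<Sum>k\<in>UNIV. g z $ j $ k * \<xi> $ j * cnj (\<xi> $ k))"
      using faithful by metis
  qed
  then show ?thesis
    unfolding hermitian_metric_on_def state_form_coefficients[OF st]
    by (intro exI[of _ g]) (simp add: g_def X_def)
qed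

text \<open>An inverse commutes with whatever the element commutes with, so all values of the
  resolvent form at \<open>z\<close> commute and every term of \<open>ext_deriv_state_form\<close>
  vanishes.\<close>

lemma closed_state_form_of_commuting:
  assumes \<phi>: "state \<phi>" and T: "commuting_tuple T"
  shows "closed_form_on (proj_resolvent_set T) (state_form \<phi> T)"
  unfolding closed_form_on_def
proof (intro ballI conjI allI)
  fix z u v w assume z: "z \<in> proj_resolvent_set T"
  show "(\<lambda>\<zeta>. state_form \<phi> T \<zeta> u v) differentiable (at z)"
    using has_derivative_state_form[OF \<phi> z] by (rule differentiableI)
  have pencil: "pencil T x * pencil T y = pencil T y * pencil T x" for x y
  proof -
    have "pencil T x * pencil T y = (\<Sum>i\<in>UNIV. \<Sum>j\<in>UNIV. (y $ j * x $ i) *\<^sub>C (T j * T i))"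
      using T by (simp add: pencil_def sum_product mult_scaleC_left mult_scaleC_right scaleC_scaleC
          commuting_tuple_def mult.commute)
    also have "\<dots> = pencil T y * pencil T x"
      by (subst sum.swap) (simp add: pencil_def sum_product mult_scaleC_left mult_scaleC_right
          scaleC_scaleC mult.commute)
    finally show ?thesis .
  qed
  define r where "r = alg_inverse (pencil T z)"
  have r: "r * pencil T x = pencil T x * r" for x
    unfolding r_def using z by (intro alg_inverse_commute pencil) (simp add: proj_resolvent_set_def)
  have "resolvent_form T z x * resolvent_form T z y = r * r * (pencil T x * pencil T y)" for x y
    by (metis r resolvent_form_eq r_def mult.assoc)
  then have "resolvent_form T z x * resolvent_form T z y = resolvent_form T z y * resolvent_form T z x" for x y
    by (metis pencil)
  then show "ext_deriv (state_form \<phi> T) z u v w = 0"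
    by (simp add: ext_deriv_state_form[OF \<phi> z] star_zero state_simps[OF \<phi>])
qed

section \<open>From closedness to commutativity\<close>

text \<open>The six terms of \<open>ext_deriv_state_form\<close> have different homogeneity types, linear or antilinear,
  in \<open>u\<close> and \<open>w\<close>, so multiplying these vectors by \<open>\<i>\<close> isolates a single term.\<close>

lemma closed_state_form_commutator:
  assumes \<phi>: "state \<phi>" and closed: "closed_form_on (proj_resolvent_set T) (state_form \<phi> T)"
    and z: "z \<in> proj_resolvent_set T"
  defines "\<omega> \<equiv> resolvent_form T z"
  shows "\<phi> (star (\<omega> v) * (\<omega> u * \<omega> w - \<omega> w * \<omega> u)) = 0"
proof -
  define c where "c x y = \<omega> x * \<omega> y - \<omega> y * \<omega> x" for x y
  define p where "p = \<phi> (star (\<omega> v) * c u w)"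
  define q where "q = \<phi> (star (\<omega> w) * c u v)"
  define r where "r = \<phi> (star (\<omega> u) * c v w)"
  define p' where "p' = \<phi> (star (c w u) * \<omega> v)"
  define q' where "q' = \<phi> (star (c u v) * \<omega> w)"
  define r' where "r' = \<phi> (star (c v w) * \<omega> u)"
  have E: "\<phi> (star (\<omega> v) * c u w) - \<phi> (star (\<omega> w) * c u v) - \<phi> (star (\<omega> u) * c v w) +
    \<phi> (star (c w u) * \<omega> v) + \<phi> (star (c u v) * \<omega> w) + \<phi> (star (c v w) * \<omega> u) = 0" for u v w
    using closed z ext_deriv_state_form[OF \<phi> z, of u v w]
    by (simp add: closed_form_on_def c_def \<omega>_def)
  have scale: "\<omega> (\<i> *s x) = \<i> *\<^sub>C \<omega> x" "c (\<i> *s x) y = \<i> *\<^sub>C c x y" "c x (\<i> *s y) = \<i> *\<^sub>C c x y" for x y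
    by (simp_all add: c_def \<omega>_def resolvent_form_scale mult_scaleC_left mult_scaleC_right
        scaleC_diff_right)
  note scale = scale star_scaleC mult_scaleC_left mult_scaleC_right scaleC_scaleC state_simps(2)[OF \<phi>]
  \<comment> \<open>\<open>E\<close> takes its variables in the order \<open>v\<close>,
    \<open>u\<close>, \<open>w\<close>. The four instances multiply neither, the first, the second,
    or both of \<open>u\<close> and \<open>w\<close> by \<open>\<i>\<close>.\<close>
  have "p - q - r + p' + q' + r' = 0"
    using E[of v u w] by (simp add: p_def q_def r_def p'_def q'_def r'_def)
  moreover have "\<i> * (p - q + r - p' - q' + r') = 0"
    using E[of v "\<i> *s u" w] by (simp add: p_def q_def r_def p'_def q'_def r'_def scale algebra_simps)
  moreover have "\<i> * (p + q - r - p' + q' - r') = 0"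
    using E[of v u "\<i> *s w"] by (simp add: p_def q_def r_def p'_def q'_def r'_def scale algebra_simps)
  moreover have "- p - q - r - p' + q' + r' = 0"
    using E[of v "\<i> *s u" "\<i> *s w"] by (simp add: p_def q_def r_def p'_def q'_def r'_def scale algebra_simps)
  \<comment> \<open>Subtracting the fourth equation from the first gives \<open>p + p' = 0\<close>;
    adding the second and third, divided by \<open>\<i>\<close>, gives
    \<open>p - p' = 0\<close>.\<close>
  ultimately have "p = 0"
    by (auto simp: complex_eq_iff)
  then show ?thesis by (simp add: p_def c_def)
qed

text \<open>The commutator is holomorphic in \<open>z\<close> whereas \<open>star (\<omega> v)\<close> is antiholomorphic, so the
  antilinear part of the derivative of the previous identity hits only the latter factor.\<close>

lemma closed_state_form_commutator_product:
  assumes \<phi>: "state \<phi>" and closed: "closed_form_on (proj_resolvent_set T) (state_form \<phi> T)"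
    and z: "z \<in> proj_resolvent_set T"
  defines "\<omega> \<equiv> resolvent_form T z"
  shows "\<phi> (star (\<omega> h * \<omega> v) * (\<omega> u * \<omega> w - \<omega> w * \<omega> u)) = 0"
proof -
  define \<rho> where "\<rho> = resolvent_form T"
  define C where "C \<zeta> = \<rho> \<zeta> u * \<rho> \<zeta> w - \<rho> \<zeta> w * \<rho> \<zeta> u" for \<zeta>
  define C' where "C' h = \<rho> z u * - (\<rho> z h * \<rho> z w) + - (\<rho> z h * \<rho> z u) * \<rho> z w
    - (\<rho> z w * - (\<rho> z h * \<rho> z u) + - (\<rho> z h * \<rho> z w) * \<rho> z u)" for h
  note d = has_derivative_resolvent_form[OF z, folded \<rho>_def]
  have "(C has_derivative C') (at z)"
    unfolding C_def[abs_def] C'_def[abs_def] by (intro has_derivative_diff has_derivative_mult d)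
  \<comment> \<open>By the previous lemma the differentiated function vanishes on the whole open
    resolvent set, so this derivative is that of a constant.\<close>
  from has_derivative_state_product[OF \<phi> d[of v] this]
  have "((\<lambda>\<zeta>. 0) has_derivative
      (\<lambda>h. \<phi> (star (- (\<rho> z h * \<rho> z v)) * C z) + \<phi> (star (\<rho> z v) * C' h))) (at z)"
    by (rule has_derivative_transform_within_open[OF _ open_proj_resolvent_set z])
      (simp add: C_def \<rho>_def closed_state_form_commutator[OF \<phi> closed])
  from fun_cong[OF has_derivative_unique[OF this has_derivative_const]]
  have 0: "\<phi> (star (- (\<rho> z h * \<rho> z v)) * C z) + \<phi> (star (\<rho> z v) * C' h) = 0" for h .
  have scale: "\<rho> z (\<i> *s h) = \<i> *\<^sub>C \<rho> z h"
    by (simp add: \<rho>_def resolvent_form_scale)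
  \<comment> \<open>Passing from \<open>h\<close> to \<open>\<i> *s h\<close> multiplies the two
    terms of \<open>0\<close> by \<open>- \<i>\<close> and \<open>\<i>\<close>; hence both their sum
    and their difference vanish.\<close>
  have "C' (\<i> *s h) = \<i> *\<^sub>C C' h"
    by (simp add: C'_def scale mult_scaleC_left mult_scaleC_right scaleC_diff_right scaleC_add_right
        scaleC_minus_right)
  then have "- \<i> * \<phi> (star (- (\<rho> z h * \<rho> z v)) * C z) + \<i> * \<phi> (star (\<rho> z v) * C' h) = 0"
    using 0[of "\<i> *s h"]
    by (simp add: scale star_scaleC star_minus mult_scaleC_left mult_scaleC_right scaleC_minus_right
        state_simps[OF \<phi>])
  with 0[of h] have "\<phi> (star (- (\<rho> z h * \<rho> z v)) * C z) = 0"
    by (auto simp: complex_eq_iff)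
  then show ?thesis
    by (simp add: C_def \<rho>_def \<omega>_def star_minus state_simps[OF \<phi>])
qed

lemma commuting_of_closed_state_form:
  fixes A :: "'n::finite \<Rightarrow> 'a::cstar_algebra"
  assumes \<phi>: "faithful_state \<phi>"
    and closed: "closed_form_on (proj_resolvent_set (hat_tuple A)) (state_form \<phi> (hat_tuple A))"
  shows "commuting_tuple (hat_tuple A)"
  unfolding commuting_tuple_def
proof (intro allI)
  fix j k
  define T where "T = hat_tuple A"
  have st: "state \<phi>"
    using \<phi> by (simp add: faithful_state_def)
  \<comment> \<open>At this base point the pencil is the unit, so the resolvent form returns the
    entries of the tuple on axis vectors.\<close>
  have p: "pencil T (axis None 1) = 1"
    unfolding pencil_axis by (simp add: T_def hat_tuple_def)
  then have z: "axis None 1 \<in> proj_resolvent_set T"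
    by (auto simp: proj_resolvent_set_def alg_invertible_def)
  have \<omega>: "resolvent_form T (axis None 1) (axis i 1) = T i" for i
    unfolding resolvent_form_eq p by (simp add: pencil_axis alg_inverse_unique[of 1 1])
  define c where "c = T j * T k - T k * T j"
  have "\<phi> (star (T h * T i) * c) = 0" for h i
    using closed_state_form_commutator_product[OF st closed[folded T_def] z,
        of "axis h 1" "axis i 1" "axis j 1" "axis k 1"]
    by (simp add: \<omega> c_def)
  \<comment> \<open>Taking both orders of \<open>j\<close> and \<open>k\<close> and subtracting
    assembles \<open>star c\<close> in the first factor.\<close>
  then have "\<phi> (star (T j * T k) * c - star (T k * T j) * c) = 0"
    by (simp add: state_simps[OF st])
  then have "\<phi> (star c * c) = 0"
    by (simp add: c_def star_diff left_diff_distrib)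
  then have "c = 0"
    using \<phi> unfolding faithful_state_def by force
  then show "hat_tuple A j * hat_tuple A k = hat_tuple A k * hat_tuple A j"
    by (simp add: c_def T_def)
qed

theorem theorem2p4:
  fixes \<phi> :: "'a::cstar_algebra \<Rightarrow> complex"
    and A :: "'n::finite \<Rightarrow> 'a"
  assumes "faithful_state \<phi>"
    and "lin_indep_tuple (hat_tuple A)"
  shows "commuting_tuple (hat_tuple A) \<longleftrightarrow>
    kaehler_metric_on (proj_resolvent_set (hat_tuple A)) (state_form \<phi> (hat_tuple A))"
proof -
  have "state \<phi>"
    using assms(1) by (simp add: faithful_state_def)
  \<comment> \<open>The hypotheses give the Hermitian metric outright, so the equivalence reduces to
    closedness.\<close>
  then show ?thesis
    using hermitian_metric_on_state_form[OF assms] closed_state_form_of_commuting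
      commuting_of_closed_state_form[OF assms(1)]
    unfolding kaehler_metric_on_def by blast
qed

end
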